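(* Let $m\ge 1$. The class of step-up procedures is closed under the union operation: if $h^u$ and $\tilde h^u$ are two step-up procedures with threshold functions $\tau^u_\alpha$ and $\tilde\tau^u_\alpha$, and $h$ is the step-up procedure with threshold function $\tau_\alpha(i)=\max(\tau^u_\alpha(i),\tilde\tau^u_\alpha(i))$, $i\in\{1,\ldots,m\}$, then $h(p,\alpha)=h^u(p,\alpha)\cup\tilde h^u(p,\alpha)$ for all $p\in[0,1]^m$ and $\alpha\in[0,1]$.
   Context: For $p\in[0,1]^m$ let $p_{(1)}\le p_{(2)}\le\cdots\le p_{(m)}$ be its ordered entries. A threshold function is a family of maps $\tau_\alpha:\{1,\ldots,m\}\to[0,1]$, $\alpha\in[0,1]$. The step-up procedure with threshold function $\tau_\alpha$ is the map sending $(p,\alpha)\in[0,1]^m\times[0,1]$ to the set of indices of rejected hypotheses $$\left\{i\in\{1,\ldots,m\}: p_i\le\max\{p_{(j)}: p_{(j)}\le\tau_\alpha(j)\}\right\},$$ where the maximum over the empty set is $-\infty$ (no rejections). *)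

theory Defs
  imports "HOL-Library.FuncSet" "HOL-Library.Extended_Real"
begin

text \<open>Points of \<open>[0,1]^m\<close> are functions on the index set \<open>{1..m}\<close>, undefined elsewhere.\<close>

definition unit_cube :: "nat \<Rightarrow> (nat \<Rightarrow> real) set" where
  "unit_cube m = {1..m} \<rightarrow>\<^sub>E {0..1}"

text \<open>The \<open>j\<close>-th smallest entry of \<open>p\<close> for \<open>j \<in> {1..m}\<close>; lists are indexed from 0.\<close>

definition ordered_entry :: "nat \<Rightarrow> (nat \<Rightarrow> real) \<Rightarrow> nat \<Rightarrow> real" where
  "ordered_entry m p j = sort (map p [1..<Suc m]) ! (j - 1)"

text \<open>The argument \<open>\<alpha>\<close> of a family comes first: \<open>\<tau> \<alpha> i\<close> stands for \<open>\<tau>\<^sub>\<alpha>(i)\<close>.\<close>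

definition threshold_function :: "nat \<Rightarrow> (real \<Rightarrow> nat \<Rightarrow> real) \<Rightarrow> bool" where
  "threshold_function m \<tau> \<longleftrightarrow> (\<forall>\<alpha>\<in>{0..1}. \<forall>i\<in>{1..m}. \<tau> \<alpha> i \<in> {0..1})"

definition max_or_minf :: "real set \<Rightarrow> ereal" where
  "max_or_minf S = (if S = {} then -\<infinity> else ereal (Max S))"

definition step_up ::
  "nat \<Rightarrow> (real \<Rightarrow> nat \<Rightarrow> real) \<Rightarrow> (nat \<Rightarrow> real) \<Rightarrow> real \<Rightarrow> nat set" where
  "step_up m \<tau> p \<alpha> =
     {i \<in> {1..m}. ereal (p i) \<le>
        max_or_minf {ordered_entry m p j | j. j \<in> {1..m} \<and> ordered_entry m p j \<le> \<tau> \<alpha> j}}"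

text \<open>A procedure has domain \<open>[0,1]^m \<times> [0,1]\<close>, so its values elsewhere are ignored.\<close>

definition step_up_procedures ::
  "nat \<Rightarrow> ((nat \<Rightarrow> real) \<Rightarrow> real \<Rightarrow> nat set) set" where
  "step_up_procedures m =
     {h. \<exists>\<tau>. threshold_function m \<tau> \<and>
          (\<forall>p\<in>unit_cube m. \<forall>\<alpha>\<in>{0..1}. h p \<alpha> = step_up m \<tau> p \<alpha>)}"

end

(* An index i is rejected iff p i \<le> p_(j) for some j with p_(j) \<le> \<tau>(j), and for the threshold
   max (\<tau> j) (\<tau>' j) the last condition is a disjunction, which commutes with the existential. *)

theory Submission
  imports Defs
begin

text \<open>For empty \<open>S\<close> both sides are false, as no real lies below
  \<open>-\<infinity>\<close>; otherwise the maximum of a finite set is attained. The value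
  \<open>-\<infinity>\<close> thus needs no separate case later on.\<close>

lemma le_max_or_minf_iff:
  assumes "finite S"
  shows "ereal x \<le> max_or_minf S \<longleftrightarrow> (\<exists>y\<in>S. x \<le> y)"
  using assms by (cases "S = {}") (simp_all add: max_or_minf_def Max_ge_iff)

lemma mem_step_up_iff:
  "i \<in> step_up m \<tau> p \<alpha> \<longleftrightarrow>
     i \<in> {1..m} \<and>
     (\<exists>j\<in>{1..m}. ordered_entry m p j \<le> \<tau> \<alpha> j \<and> p i \<le> ordered_entry m p j)"
proof -
  let ?S = "{ordered_entry m p j | j. j \<in> {1..m} \<and> ordered_entry m p j \<le> \<tau> \<alpha> j}"
  have "ereal (p i) \<le> max_or_minf ?S \<longleftrightarrow> (\<exists>x\<in>?S. p i \<le> x)"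
    \<comment> \<open>The remaining goal is finiteness of the set, which is the image of a subset of
      \<open>{1..m}\<close>.\<close>
    by (rule le_max_or_minf_iff) simp
  then show ?thesis
    unfolding step_up_def by blast
qed

lemma step_up_max:
  "step_up m (\<lambda>\<alpha> i. max (\<tau> \<alpha> i) (\<tau>' \<alpha> i)) p \<alpha> = step_up m \<tau> p \<alpha> \<union> step_up m \<tau>' p \<alpha>"
  by (rule set_eqI) (simp only: Un_iff mem_step_up_iff le_max_iff_disj, blast)

lemma threshold_function_max:
  assumes "threshold_function m \<tau>" "threshold_function m \<tau>'"
  shows "threshold_function m (\<lambda>\<alpha> i. max (\<tau> \<alpha> i) (\<tau>' \<alpha> i))"
  using assms by (auto simp: threshold_function_def le_max_iff_disj)

text \<open>Membership in the class provides a threshold function for each procedure, and their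
  pointwise maximum is one for the union.\<close>

lemma step_up_procedures_Un:
  assumes "h \<in> step_up_procedures m" "h' \<in> step_up_procedures m"
  shows "(\<lambda>p \<alpha>. h p \<alpha> \<union> h' p \<alpha>) \<in> step_up_procedures m"
proof -
  from assms obtain \<tau> \<tau>' where
    \<tau>: "threshold_function m \<tau>" "\<forall>p\<in>unit_cube m. \<forall>\<alpha>\<in>{0..1}. h p \<alpha> = step_up m \<tau> p \<alpha>" and
    \<tau>': "threshold_function m \<tau>'" "\<forall>p\<in>unit_cube m. \<forall>\<alpha>\<in>{0..1}. h' p \<alpha> = step_up m \<tau>' p \<alpha>"
    unfolding step_up_procedures_def by blast
  show ?thesis
    unfolding step_up_procedures_def mem_Collect_eq
    \<comment> \<open>The equations for \<open>h\<close> and \<open>h'\<close> hold on the cube,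
      exactly where the new one is required.\<close>
    by (rule exI[of _ "\<lambda>\<alpha> i. max (\<tau> \<alpha> i) (\<tau>' \<alpha> i)"])
       (simp add: threshold_function_max step_up_max \<tau> \<tau>')
qed

text \<open>Closure of the class only asserts that some threshold function realises the union; the
  second conjunct identifies one explicitly.\<close>

theorem mainTheorem2:
  fixes m :: nat
  assumes "m \<ge> 1"
  shows "(\<forall>h \<in> step_up_procedures m. \<forall>h' \<in> step_up_procedures m.
            (\<lambda>p \<alpha>. h p \<alpha> \<union> h' p \<alpha>) \<in> step_up_procedures m) \<and>
         (\<forall>\<tau> \<tau>'. threshold_function m \<tau> \<longrightarrow> threshold_function m \<tau>' \<longrightarrow>
            threshold_function m (\<lambda>\<alpha> i. max (\<tau> \<alpha> i) (\<tau>' \<alpha> i)) \<and>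
            (\<forall>p \<in> unit_cube m. \<forall>\<alpha> \<in> {0..1}.
               step_up m (\<lambda>\<alpha> i. max (\<tau> \<alpha> i) (\<tau>' \<alpha> i)) p \<alpha> =
               step_up m \<tau> p \<alpha> \<union> step_up m \<tau>' p \<alpha>))"
  by (simp add: step_up_procedures_Un threshold_function_max step_up_max)

end
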